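(* Let $N,n,J,k\in\mathbb{N}$ (positive integers) with $k\cdot J=n$, let $\mathbf{A}\in\mathbb{C}^{N\times N}$, and let $$\mathbf{A}\cdot\mathbf{V}=\overline{\mathbf{V}}\cdot\overline{\mathbf{H}}$$ be a Hessenberg decomposition of size $n$, where $\mathbf{V}=[\mathbf{v}_1,\dots,\mathbf{v}_n]\in\mathbb{C}^{N\times n}$, $\overline{\mathbf{V}}=[\mathbf{v}_1,\dots,\mathbf{v}_n,\mathbf{v}_{n+1}]\in\mathbb{C}^{N\times(n+1)}$, $\overline{\mathbf{H}}\in\mathbb{C}^{(n+1)\times n}$ is upper Hessenberg, and $\mathbf{H}\in\mathbb{C}^{n\times n}$ consists of the first $n$ rows of $\overline{\mathbf{H}}$. Put $$\widetilde{\mathbf{V}}:=[\mathbf{v}_1,\mathbf{v}_{1+J},\mathbf{v}_{1+2J},\dots,\mathbf{v}_{1+(k-1)J}]\in\mathbb{C}^{N\times k}.$$ Then, from $J$, $k$ and $\mathbf{H}$, one can compute and store a permutation matrix $\mathbf{\Pi}\in\mathbb{C}^{n\times n}$ in $\mathcal{O}(n)$ and an upper triangular matrix $\mathbf{K}\in\mathbb{C}^{n\times n}$ in $\mathcal{O}(n^3)$ (and in $\mathcal{O}(n^2)$ if $\mathbf{H}$ is banded) such that $$\mathbf{V}\cdot\mathbf{K}=[\widetilde{\mathbf{V}},\ \mathbf{A}\cdot\widetilde{\mathbf{V}},\ \dots,\ \mathbf{A}^{J-1}\cdot\widetilde{\mathbf{V}}]\cdot\mathbf{\Pi}.$$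
   Context: A matrix $\overline{\mathbf{H}}\in\mathbb{C}^{(n+1)\times n}$ is upper Hessenberg if its entries satisfy $h_{i,j}=0$ whenever $i>j+1$. In a Hessenberg decomposition $\mathbf{A}\mathbf{V}=\overline{\mathbf{V}}\,\overline{\mathbf{H}}$, the matrix $\overline{\mathbf{V}}$ is $\mathbf{V}$ with one further column $\mathbf{v}_{n+1}$ appended on the right, and $\overline{\mathbf{H}}$ is the square Hessenberg matrix $\mathbf{H}$ with one further row appended at the bottom. No orthogonality of the columns of $\mathbf{V}$ is assumed. The block matrix $[\widetilde{\mathbf{V}},\mathbf{A}\widetilde{\mathbf{V}},\dots,\mathbf{A}^{J-1}\widetilde{\mathbf{V}}]$ has size $N\times n$ (it consists of $J$ blocks of $k$ columns). The costs $\mathcal{O}(\cdot)$ count arithmetic/elementary operations and memory, with $\mathcal{O}$-constants independent of $n$, $J$, $k$, $N$; "banded" means that $\mathbf{H}$ has a bandwidth bounded by a constant independent of $n$ (on which the $\mathcal{O}$-constant may depend). *)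

theory Defs
  imports "Jordan_Normal_Form.Matrix" "HOL-Combinatorics.Permutations"
begin

section \<open>Matrices\<close>

text \<open>Rows and columns are indexed from 0, so the vector written \<open>v\<^sub>1\<close> on paper is column 0.\<close>

definition append_col :: "'a mat \<Rightarrow> 'a vec \<Rightarrow> 'a mat" where
  "append_col V v = mat_of_cols (dim_row V) (cols V @ [v])"

definition first_rows :: "nat \<Rightarrow> 'a mat \<Rightarrow> 'a mat" where
  "first_rows m M = mat m (dim_col M) (\<lambda>(i, j). M $$ (i, j))"

definition upper_hessenberg :: "'a :: zero mat \<Rightarrow> bool" where
  "upper_hessenberg M \<longleftrightarrow>
     (\<forall>i < dim_row M. \<forall>j < dim_col M. i > j + 1 \<longrightarrow> M $$ (i, j) = 0)"

definition hessenberg_decomposition ::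
    "nat \<Rightarrow> nat \<Rightarrow> complex mat \<Rightarrow> complex mat \<Rightarrow> complex vec \<Rightarrow> complex mat \<Rightarrow> bool" where
  "hessenberg_decomposition N n A V v Hbar \<longleftrightarrow>
     A \<in> carrier_mat N N \<and> V \<in> carrier_mat N n \<and> v \<in> carrier_vec N \<and>
     Hbar \<in> carrier_mat (n + 1) n \<and> upper_hessenberg Hbar \<and>
     A * V = append_col V v * Hbar"

definition banded :: "nat \<Rightarrow> 'a :: zero mat \<Rightarrow> bool" where
  "banded b M \<longleftrightarrow>
     (\<forall>i < dim_row M. \<forall>j < dim_col M. i > j + b \<or> j > i + b \<longrightarrow> M $$ (i, j) = 0)"

definition strided_cols :: "nat \<Rightarrow> nat \<Rightarrow> 'a mat \<Rightarrow> 'a mat" where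
  "strided_cols J k V = mat_of_cols (dim_row V) (map (\<lambda>i. col V (i * J)) [0..<k])"

definition block_krylov :: "nat \<Rightarrow> 'a :: semiring_1 mat \<Rightarrow> 'a mat \<Rightarrow> 'a mat" where
  "block_krylov J A W = mat_of_cols (dim_row W) (concat (map (\<lambda>j. cols (A ^\<^sub>m j * W)) [0..<J]))"

definition matrix_of_perm :: "nat \<Rightarrow> (nat \<Rightarrow> nat) \<Rightarrow> complex mat" where
  "matrix_of_perm n p = mat n n (\<lambda>(i, j). if i = p j then 1 else 0)"

definition permutation_matrix :: "nat \<Rightarrow> complex mat \<Rightarrow> bool" where
  "permutation_matrix n M \<longleftrightarrow> (\<exists>p. p permutes {..<n} \<and> M = matrix_of_perm n p)"


section \<open>Cost model\<close>

text \<open>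
  A unit-cost random access machine with natural-number indices and exact complex arithmetic.
  Programs are finite syntax, independent of the problem size.
  The machine has index registers, one-dimensional index arrays and two-dimensional complex
  arrays; register and array names are literals in the program, whereas positions inside an
  array are computed.

  The only literals are natural numbers and the complex numbers 0 and 1.  Indices can only be
  added and subtracted, and the only information that flows from complex data to indices is
  whether two complex values are equal.
\<close>

record store =
  ireg :: "nat \<Rightarrow> nat"
  iarr :: "nat \<Rightarrow> nat \<Rightarrow> nat"
  carr :: "nat \<Rightarrow> nat \<Rightarrow> nat \<Rightarrow> complex"

datatype cell = RegCell nat | IdxCell nat nat | NumCell nat nat nat

datatype iexp =
    ILit nat
  | IReg nat
  | IRead nat iexp
  | IAdd iexp iexp
  | ISub iexp iexp

datatype cexp =
    CZero
  | COne
  | CRead nat iexp iexp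
  | CAdd cexp cexp
  | CSub cexp cexp
  | CMul cexp cexp
  | CDiv cexp cexp

datatype bexp =
    ILess iexp iexp
  | CEq cexp cexp
  | BNot bexp
  | BAnd bexp bexp

datatype com =
    Skip
  | SetReg nat iexp
  | SetIdx nat iexp iexp
  | SetNum nat iexp iexp cexp
  | Seq com com
  | Cond bexp com com
  | Loop bexp com

primrec ival :: "iexp \<Rightarrow> store \<Rightarrow> nat" where
  "ival (ILit m) s = m"
| "ival (IReg x) s = ireg s x"
| "ival (IRead a e) s = iarr s a (ival e s)"
| "ival (IAdd e f) s = ival e s + ival f s"
| "ival (ISub e f) s = ival e s - ival f s"

primrec cval :: "cexp \<Rightarrow> store \<Rightarrow> complex" where
  "cval CZero s = 0"
| "cval COne s = 1"
| "cval (CRead a e f) s = carr s a (ival e s) (ival f s)"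
| "cval (CAdd e f) s = cval e s + cval f s"
| "cval (CSub e f) s = cval e s - cval f s"
| "cval (CMul e f) s = cval e s * cval f s"
| "cval (CDiv e f) s = cval e s / cval f s"

primrec bval :: "bexp \<Rightarrow> store \<Rightarrow> bool" where
  "bval (ILess e f) s \<longleftrightarrow> ival e s < ival f s"
| "bval (CEq e f) s \<longleftrightarrow> cval e s = cval f s"
| "bval (BNot b) s \<longleftrightarrow> \<not> bval b s"
| "bval (BAnd b c) s \<longleftrightarrow> bval b s \<and> bval c s"

text \<open>Every literal, memory access, arithmetic operation, comparison and connective costs one unit.\<close>

primrec icost :: "iexp \<Rightarrow> nat" where
  "icost (ILit m) = 1"
| "icost (IReg x) = 1"
| "icost (IRead a e) = 1 + icost e"
| "icost (IAdd e f) = 1 + icost e + icost f"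
| "icost (ISub e f) = 1 + icost e + icost f"

primrec ccost :: "cexp \<Rightarrow> nat" where
  "ccost CZero = 1"
| "ccost COne = 1"
| "ccost (CRead a e f) = 1 + icost e + icost f"
| "ccost (CAdd e f) = 1 + ccost e + ccost f"
| "ccost (CSub e f) = 1 + ccost e + ccost f"
| "ccost (CMul e f) = 1 + ccost e + ccost f"
| "ccost (CDiv e f) = 1 + ccost e + ccost f"

primrec bcost :: "bexp \<Rightarrow> nat" where
  "bcost (ILess e f) = 1 + icost e + icost f"
| "bcost (CEq e f) = 1 + ccost e + ccost f"
| "bcost (BNot b) = 1 + bcost b"
| "bcost (BAnd b c) = 1 + bcost b + bcost c"

text \<open>
  \<open>exec c s t W s'\<close>: started in \<open>s\<close>, program \<open>c\<close> terminates in \<open>s'\<close> after \<open>t\<close> elementary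
  operations, and \<open>W\<close> is the set of memory cells it has written.  Memory is never released,
  so \<open>card W\<close> is the memory used on top of the input.
\<close>

inductive exec :: "com \<Rightarrow> store \<Rightarrow> nat \<Rightarrow> cell set \<Rightarrow> store \<Rightarrow> bool" where
  Skip: "exec Skip s 1 {} s"
| SetReg: "exec (SetReg x e) s (1 + icost e) {RegCell x}
     (s\<lparr>ireg := (ireg s)(x := ival e s)\<rparr>)"
| SetIdx: "exec (SetIdx a e f) s (1 + icost e + icost f) {IdxCell a (ival e s)}
     (s\<lparr>iarr := (iarr s)(a := (iarr s a)(ival e s := ival f s))\<rparr>)"
| SetNum: "exec (SetNum a e f g) s (1 + icost e + icost f + ccost g)
     {NumCell a (ival e s) (ival f s)}
     (s\<lparr>carr := (carr s)(a := (carr s a)(ival e s :=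
        (carr s a (ival e s))(ival f s := cval g s)))\<rparr>)"
| Seq: "exec c s t W s' \<Longrightarrow> exec d s' t' W' s'' \<Longrightarrow> exec (Seq c d) s (t + t') (W \<union> W') s''"
| CondTrue: "bval b s \<Longrightarrow> exec c s t W s' \<Longrightarrow> exec (Cond b c d) s (1 + bcost b + t) W s'"
| CondFalse: "\<not> bval b s \<Longrightarrow> exec d s t W s' \<Longrightarrow> exec (Cond b c d) s (1 + bcost b + t) W s'"
| LoopFalse: "\<not> bval b s \<Longrightarrow> exec (Loop b c) s (1 + bcost b) {} s"
| LoopTrue: "bval b s \<Longrightarrow> exec c s t W s' \<Longrightarrow> exec (Loop b c) s' t' W' s'' \<Longrightarrow>
     exec (Loop b c) s (1 + bcost b + t + t') (W \<union> W') s''"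

inductive_cases exec_SkipE: "exec Skip s t W s'"
inductive_cases exec_SetRegE: "exec (SetReg x e) s t W s'"
inductive_cases exec_SetIdxE: "exec (SetIdx a e f) s t W s'"
inductive_cases exec_SetNumE: "exec (SetNum a e f g) s t W s'"
inductive_cases exec_SeqE: "exec (Seq c d) s t W s'"
inductive_cases exec_CondE: "exec (Cond b c d) s t W s'"
inductive_cases exec_LoopE: "exec (Loop b c) s t W s'"

lemma exec_deterministic:
  assumes "exec c s t W s'" and "exec c s t' W' s''"
  shows "t' = t \<and> W' = W \<and> s'' = s'"
  using assms
proof (induction arbitrary: t' W' s'' rule: exec.induct)
  case (Seq c s t W s1 d t1 W1 s2)
  from Seq.prems obtain u X r u' X' where
    "exec c s u X r" "exec d r u' X' s''" "t' = u + u'" "W' = X \<union> X'"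
    by (rule exec_SeqE)
  with Seq.IH show ?case by metis
next
  case (CondTrue b s c t W s1 d)
  then obtain u where "exec c s u W' s''" "t' = 1 + bcost b + u"
    by (auto elim: exec_CondE)
  with CondTrue.IH show ?case by metis
next
  case (CondFalse b s d t W s1 c)
  then obtain u where "exec d s u W' s''" "t' = 1 + bcost b + u"
    by (auto elim: exec_CondE)
  with CondFalse.IH show ?case by metis
next
  case (LoopFalse b s c)
  from LoopFalse.prems show ?case
    by (rule exec_LoopE) (simp_all add: LoopFalse.hyps)
next
  case (LoopTrue b s c t W s1 t1 W1 s2)
  from LoopTrue.prems obtain u X r u' X' where
    "exec c s u X r" "exec (Loop b c) r u' X' s''" "t' = 1 + bcost b + u + u'" "W' = X \<union> X'"
    by (rule exec_LoopE) (simp_all add: LoopTrue.hyps)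
  with LoopTrue.IH show ?case by metis
qed (erule exec_SkipE exec_SetRegE exec_SetIdxE exec_SetNumE; simp)+

lemma exec_finite: "exec c s t W s' \<Longrightarrow> finite W"
  by (induction rule: exec.induct) auto

text \<open>
  Input: index registers 0 and 1 hold \<open>J\<close> and \<open>k\<close>, complex array 0 holds \<open>H\<close>; everything else
  is zero.
\<close>

definition input_store :: "nat \<Rightarrow> nat \<Rightarrow> complex mat \<Rightarrow> store" where
  "input_store J k H =
    \<lparr>ireg = (\<lambda>_. 0)(0 := J, 1 := k),
     iarr = (\<lambda>_ _. 0),
     carr = (\<lambda>a i j. if a = 0 \<and> i < dim_row H \<and> j < dim_col H then H $$ (i, j) else 0)\<rparr>"

text \<open>
  Output: a permutation matrix is stored as the list of the row positions of the ones in columns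
  \<open>0, \<dots>, n - 1\<close> (index array 0), since its \<open>n\<^sup>2\<close> entries cannot be written in linear time;
  any other matrix is stored entrywise (complex array 1).
\<close>

definition stored_perm_matrix :: "nat \<Rightarrow> store \<Rightarrow> complex mat" where
  "stored_perm_matrix n s = matrix_of_perm n (iarr s 0)"

definition stored_matrix :: "nat \<Rightarrow> store \<Rightarrow> complex mat" where
  "stored_matrix n s = mat n n (\<lambda>(i, j). carr s 1 i j)"

end

theory Submission
  imports Defs
begin

text \<open>
  Column \<open>c = i J + j\<close> (\<open>j < J\<close>) of \<open>K\<close> is \<open>H\<^sup>j e\<^bsub>iJ\<^esub>\<close>, so each column is either a unit vector or
  \<open>H\<close> times the preceding column.  Since \<open>H\<close> is Hessenberg, this column vanishes below row \<open>c\<close>;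
  hence the last row of \<open>Hbar\<close> does not contribute before the power \<open>J\<close> is reached, and
  \<open>V H\<^sup>j e\<^bsub>iJ\<^esub> = A\<^sup>j V e\<^bsub>iJ\<^esub>\<close>, which is column \<open>j k + i\<close> of the block Krylov matrix.
  Each of the \<open>n\<^sup>2\<close> entries of \<open>K\<close> is a sum over one row of \<open>H\<close>, of length at most the upper
  bandwidth plus 2.
\<close>

section \<open>Reasoning about programs\<close>

text \<open>Each assignment costs at least one unit and writes one cell, so every time bound is also
  a memory bound.\<close>

lemma card_written_le: "exec c s t W s' \<Longrightarrow> card W \<le> t"
proof (induction rule: exec.induct)
  case (Seq c s t W s' d t' W' s'')
  then show ?case using card_Un_le [of W W'] by linarith
next
  case (LoopTrue b s c t W s' t' W' s'')
  then show ?case using card_Un_le [of W W'] by linarith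
qed auto

text \<open>Total correctness with time: \<open>Q\<close> sees the cost and the final store. The
  written cells are dropped, since time already bounds memory.\<close>

definition runs :: "com \<Rightarrow> store \<Rightarrow> (nat \<Rightarrow> store \<Rightarrow> bool) \<Rightarrow> bool" where
  "runs c s Q \<longleftrightarrow> (\<exists>t W s'. exec c s t W s' \<and> Q t s')"

lemma runs_mono: "runs c s P \<Longrightarrow> (\<And>t s'. P t s' \<Longrightarrow> Q t s') \<Longrightarrow> runs c s Q"
  unfolding runs_def by blast

text \<open>As equations, this rule and its companions let the simplifier compute cost and final
  store of loop-free code.\<close>

lemma runs_Skip [simp]: "runs Skip s Q \<longleftrightarrow> Q 1 s"
  unfolding runs_def by (auto elim: exec_SkipE intro: exec.Skip [simplified])

lemma runs_SetReg [simp]: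
  "runs (SetReg x e) s Q \<longleftrightarrow> Q (1 + icost e) (s\<lparr>ireg := (ireg s)(x := ival e s)\<rparr>)"
  unfolding runs_def by (fastforce elim: exec_SetRegE intro: exec.SetReg)

lemma runs_SetIdx [simp]:
  "runs (SetIdx a e f) s Q \<longleftrightarrow> Q (1 + icost e + icost f)
     (s\<lparr>iarr := (iarr s)(a := (iarr s a)(ival e s := ival f s))\<rparr>)"
  unfolding runs_def by (fastforce elim: exec_SetIdxE intro: exec.SetIdx)

lemma runs_SetNum [simp]:
  "runs (SetNum a e f g) s Q \<longleftrightarrow> Q (1 + icost e + icost f + ccost g)
     (s\<lparr>carr := (carr s)(a := (carr s a)(ival e s :=
        (carr s a (ival e s))(ival f s := cval g s)))\<rparr>)"
  unfolding runs_def by (fastforce elim: exec_SetNumE intro: exec.SetNum)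

lemma runs_Seq [simp]:
  "runs (Seq c d) s Q \<longleftrightarrow> runs c s (\<lambda>t s'. runs d s' (\<lambda>t' s''. Q (t + t') s''))"
  unfolding runs_def
proof safe
  fix t W s'' assume "exec (Seq c d) s t W s''" "Q t s''"
  then show "\<exists>t W s'. exec c s t W s' \<and> (\<exists>t' W' s''. exec d s' t' W' s'' \<and> Q (t + t') s'')"
    by (elim exec_SeqE) blast
qed (blast intro: exec.Seq)

lemma runs_Cond [simp]:
  "runs (Cond b c d) s Q \<longleftrightarrow>
     (if bval b s then runs c s (\<lambda>t. Q (1 + bcost b + t)) else runs d s (\<lambda>t. Q (1 + bcost b + t)))"
proof (cases "bval b s")
  case True
  then show ?thesis
    unfolding runs_def by (auto elim!: exec_CondE) (blast intro: exec.CondTrue [of b s, simplified])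
next
  case False
  then show ?thesis
    unfolding runs_def by (auto elim!: exec_CondE) (blast intro: exec.CondFalse [of b s, simplified])
qed

text \<open>\<open>I\<close> is indexed by the number of completed iterations, so it also yields
  termination after exactly \<open>m\<close> of them. The failing test at the end is charged
  separately.\<close>

lemma runs_Loop_steps:
  assumes "i \<le> m" and "I i s"
    and step: "\<And>i s. i < m \<Longrightarrow> I i s \<Longrightarrow> bval b s \<and> runs c s (\<lambda>t s'. t \<le> T \<and> I (Suc i) s')"
    and exit: "\<And>s. I m s \<Longrightarrow> \<not> bval b s"
  shows "runs (Loop b c) s (\<lambda>t s'. t \<le> (m - i) * (T + bcost b + 1) + bcost b + 1 \<and> I m s')"
  using assms(1,2)
proof (induction "m - i" arbitrary: i s)
  case 0
  then have "I m s" by simp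
  then have "exec (Loop b c) s (1 + bcost b) {} s"
    using exit by (intro exec.LoopFalse) blast
  then show ?case unfolding runs_def using \<open>I m s\<close> by fastforce
next
  case (Suc d)
  then have "i < m" by linarith
  with step Suc.prems obtain t W s' where b: "bval b s" and c: "exec c s t W s'"
    and t: "t \<le> T" and "I (Suc i) s'"
    unfolding runs_def by blast
  with Suc.hyps(1) [of "Suc i" s'] Suc.hyps(2) \<open>i < m\<close> obtain t' W' s'' where
    l: "exec (Loop b c) s' t' W' s''" and "I m s''"
    and t': "t' \<le> (m - Suc i) * (T + bcost b + 1) + bcost b + 1"
    unfolding runs_def by fastforce
  have "m - i = Suc (m - Suc i)" using \<open>i < m\<close> by simp
  then have "1 + bcost b + t + t' \<le> (m - i) * (T + bcost b + 1) + bcost b + 1"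
    using t t' by simp
  then show ?case
    unfolding runs_def using exec.LoopTrue [OF b c l] \<open>I m s''\<close> by blast
qed

lemma runs_Loop:
  assumes "I 0 s"
    and "\<And>i s. i < m \<Longrightarrow> I i s \<Longrightarrow> bval b s \<and> runs c s (\<lambda>t s'. t \<le> T \<and> I (Suc i) s')"
    and "\<And>s. I m s \<Longrightarrow> \<not> bval b s"
    and "\<And>t s'. t \<le> m * (T + bcost b + 1) + bcost b + 1 \<Longrightarrow> I m s' \<Longrightarrow> Q t s'"
  shows "runs (Loop b c) s Q"
  using runs_Loop_steps [of 0 m I s b c T, OF _ assms(1,2,3)] assms(4)
  by (auto elim: runs_mono)

section \<open>The permutation\<close>

text \<open>Transposition of a \<open>k\<close> by \<open>J\<close> grid: position
  \<open>i * J + j\<close> with \<open>j < J\<close> goes to \<open>j * k + i\<close>.\<close>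

definition stride_perm :: "nat \<Rightarrow> nat \<Rightarrow> nat \<Rightarrow> nat" where
  "stride_perm J k c = (c mod J) * k + c div J"

text \<open>
  Registers: 2 is the column \<open>i J + j\<close>, 3 and 4 are \<open>i\<close> and \<open>j\<close>, and 5 is \<open>j k + i\<close>, advanced by
  additions because indices cannot be multiplied.
\<close>

definition perm_row_com :: com where
  "perm_row_com =
     Loop (ILess (IReg 4) (IReg 0))
       (Seq (SetIdx 0 (IReg 2) (IReg 5))
       (Seq (SetReg 2 (IAdd (IReg 2) (ILit 1)))
       (Seq (SetReg 5 (IAdd (IReg 5) (IReg 1)))
            (SetReg 4 (IAdd (IReg 4) (ILit 1))))))"

definition perm_com :: com where
  "perm_com =
     Loop (ILess (IReg 3) (IReg 1))
       (Seq (SetReg 5 (IReg 3))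
       (Seq (SetReg 4 (ILit 0))
       (Seq perm_row_com
            (SetReg 3 (IAdd (IReg 3) (ILit 1))))))"

lemma runs_perm_row_com:
  assumes "ireg s 0 = J" "ireg s 1 = k" "ireg s 2 = i * J" "ireg s 3 = i" "ireg s 4 = 0" "ireg s 5 = i"
    and "\<forall>c < i * J. iarr s 0 c = stride_perm J k c"
  shows "runs perm_row_com s (\<lambda>t s'. t \<le> 19 * J + 4 \<and>
    ireg s' 0 = J \<and> ireg s' 1 = k \<and> ireg s' 2 = i * J + J \<and> ireg s' 3 = i \<and>
    (\<forall>c < i * J + J. iarr s' 0 c = stride_perm J k c))"
  unfolding perm_row_com_def
  \<comment> \<open>\<open>T = 15\<close> is the cost of the four assignments; the test adds 4,
    which gives 19 per iteration.\<close>
  apply (rule runs_Loop [where m = J and T = 15 and I = "\<lambda>j s'.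
    ireg s' 0 = J \<and> ireg s' 1 = k \<and> ireg s' 2 = i * J + j \<and> ireg s' 3 = i \<and> ireg s' 4 = j \<and>
    ireg s' 5 = j * k + i \<and> (\<forall>c < i * J + j. iarr s' 0 c = stride_perm J k c)"])
  using assms by (auto simp: stride_perm_def less_Suc_eq)

lemma runs_perm_com:
  assumes "ireg s 0 = J" "ireg s 1 = k" "ireg s 2 = 0" "ireg s 3 = 0"
  shows "runs perm_com s (\<lambda>t s'. t \<le> k * (19 * J + 16) + 4 \<and>
    (\<forall>c < k * J. iarr s' 0 c = stride_perm J k c))"
  unfolding perm_com_def
  apply (rule runs_Loop [where m = k and T = "19 * J + 12" and I = "\<lambda>i s'.
    ireg s' 0 = J \<and> ireg s' 1 = k \<and> ireg s' 2 = i * J \<and> ireg s' 3 = i \<and>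
    (\<forall>c < i * J. iarr s' 0 c = stride_perm J k c)"])
     apply (use assms in simp)
  subgoal for i s
    apply simp
    apply (rule runs_mono [OF runs_perm_row_com [where J = J and k = k and i = i]])
    by (auto simp: add.commute)
  by (auto simp: algebra_simps)

lemma stride_perm_less:
  assumes "c < k * J"
  shows "stride_perm J k c < k * J"
proof -
  have J: "J > 0" using assms by (cases J) auto
  then have "c mod J + 1 \<le> J" by (simp add: Suc_le_eq)
  then have "(c mod J + 1) * k \<le> J * k" by (rule mult_le_mono1)
  moreover have "c div J < k" using assms by (simp add: less_mult_imp_div_less)
  ultimately show ?thesis by (simp add: stride_perm_def algebra_simps)
qed

text \<open>Transposing the transposed grid undoes the map: as \<open>c div J < k\<close>, division
  of the image by \<open>k\<close> has quotient \<open>c mod J\<close> and remainder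
  \<open>c div J\<close>.\<close>

lemma stride_perm_inverse:
  assumes "c < k * J"
  shows "stride_perm k J (stride_perm J k c) = c"
proof -
  have "c div J < k" using assms by (simp add: less_mult_imp_div_less)
  then show ?thesis by (simp add: stride_perm_def)
qed

lemma permutation_matrix_stride_perm:
  assumes "\<forall>c < k * J. p c = stride_perm J k c"
  shows "permutation_matrix (k * J) (matrix_of_perm (k * J) p)"
proof -
  \<comment> \<open>\<open>permutes\<close> demands the identity outside the index set, where
    nothing is known about \<open>p\<close>; the matrix sees only indices below
    \<open>k * J\<close>.\<close>
  define q where "q = (\<lambda>c. if c < k * J then stride_perm J k c else c)"
  have inj: "inj_on q {..<k * J}"
    by (rule inj_on_inverseI [where g = "stride_perm k J"]) (simp add: q_def stride_perm_inverse)
  have "q ` {..<k * J} \<subseteq> {..<k * J}"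
    by (auto simp: q_def stride_perm_less)
  with inj have "bij_betw q {..<k * J} {..<k * J}"
    by (simp add: bij_betw_def endo_inj_surj)
  then have "q permutes {..<k * J}"
    by (rule bij_imp_permutes) (simp add: q_def)
  moreover have "matrix_of_perm (k * J) p = matrix_of_perm (k * J) q"
    using assms by (auto simp: matrix_of_perm_def q_def)
  ultimately show ?thesis unfolding permutation_matrix_def by blast
qed

section \<open>The triangular factor\<close>

primrec krylov_coeff :: "(nat \<Rightarrow> nat \<Rightarrow> complex) \<Rightarrow> nat \<Rightarrow> nat \<Rightarrow> nat \<Rightarrow> nat \<Rightarrow> complex" where
  "krylov_coeff h n J 0 r = (if r = 0 then 1 else 0)"
| "krylov_coeff h n J (Suc c) r =
     (if Suc c mod J = 0 then (if r = Suc c then 1 else 0)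
      else \<Sum>l<n. h r l * krylov_coeff h n J c l)"

lemma krylov_coeff_restart:
  "c mod J = 0 \<Longrightarrow> krylov_coeff h n J c r = (if r = c then 1 else 0)"
  by (cases c) auto

lemma krylov_coeff_step:
  assumes "c mod J \<noteq> 0"
  shows "krylov_coeff h n J c r = (\<Sum>l<n. h r l * krylov_coeff h n J (c - 1) l)"
  using assms by (cases c) auto

text \<open>A Hessenberg matrix moves the support of a vector down by at most one row, while the
  column index grows by one; a restart puts its single entry on the diagonal.\<close>

lemma krylov_coeff_upper:
  assumes "\<And>r l. l + 1 < r \<Longrightarrow> h r l = 0"
  shows "c < r \<Longrightarrow> krylov_coeff h n J c r = 0"
proof (induction c arbitrary: r)
  case (Suc c)
  have "h r l * krylov_coeff h n J c l = 0" for l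
    using Suc.IH [of l] assms [of l r] Suc.prems by (cases "c < l") auto
  then have "(\<Sum>l<n. h r l * krylov_coeff h n J c l) = 0"
    by (intro sum.neutral) blast
  then show ?case using Suc.prems by simp
qed simp

text \<open>
  The band limits are not part of the input, so the upper bandwidth is measured first; without it
  the sums below would have length \<open>n\<close> even for a banded matrix.  Registers: 2 is \<open>n\<close>, 3 is the
  upper bandwidth, 7 is the current column \<open>c\<close>, 8 is \<open>c mod J\<close>, 9 is the current row, and 10 and 11
  delimit the sum.
\<close>

definition size_com :: com where
  "size_com =
     Loop (ILess (IReg 4) (IReg 1))
       (Seq (SetReg 2 (IAdd (IReg 2) (IReg 0)))
            (SetReg 4 (IAdd (IReg 4) (ILit 1))))"

text \<open>Index subtraction truncates at 0, so entries on or below the diagonal never raise the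
  width.\<close>

definition scan_row_com :: com where
  "scan_row_com =
     Loop (ILess (IReg 6) (IReg 2))
       (Seq (Cond (BAnd (BNot (CEq (CRead 0 (IReg 5) (IReg 6)) CZero))
                        (ILess (IReg 3) (ISub (IReg 6) (IReg 5))))
               (SetReg 3 (ISub (IReg 6) (IReg 5)))
               Skip)
            (SetReg 6 (IAdd (IReg 6) (ILit 1))))"

definition scan_com :: com where
  "scan_com =
     Loop (ILess (IReg 5) (IReg 2))
       (Seq (SetReg 6 (ILit 0))
       (Seq scan_row_com
            (SetReg 5 (IAdd (IReg 5) (ILit 1)))))"

definition entry_com :: com where
  "entry_com =
     Loop (ILess (IReg 10) (IReg 11))
       (Seq (SetNum 1 (IReg 9) (IReg 7)
              (CAdd (CRead 1 (IReg 9) (IReg 7))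
                 (CMul (CRead 0 (IReg 9) (IReg 10))
                       (CRead 1 (IReg 10) (ISub (IReg 7) (ILit 1))))))
            (SetReg 10 (IAdd (IReg 10) (ILit 1))))"

text \<open>The upper limit of the sum may exceed \<open>n\<close>; array 0 is zero there, so the
  extra terms vanish.\<close>

definition column_com :: com where
  "column_com =
     Loop (ILess (IReg 9) (IReg 2))
       (Seq (SetReg 10 (ISub (IReg 9) (ILit 1)))
       (Seq (SetReg 11 (IAdd (IAdd (IReg 9) (IReg 3)) (ILit 1)))
       (Seq entry_com
            (SetReg 9 (IAdd (IReg 9) (ILit 1))))))"

text \<open>For lack of a remainder operation, \<open>c mod J\<close> is maintained by counting up
  and wrapping at \<open>J\<close>.\<close>

definition fill_com :: com where
  "fill_com =
     Loop (ILess (IReg 7) (IReg 2))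
       (Seq (Cond (ILess (IReg 8) (ILit 1))
               (SetNum 1 (IReg 7) (IReg 7) COne)
               (Seq (SetReg 9 (ILit 0)) column_com))
       (Seq (SetReg 7 (IAdd (IReg 7) (ILit 1)))
       (Seq (SetReg 8 (IAdd (IReg 8) (ILit 1)))
            (Cond (ILess (IReg 8) (IReg 0)) Skip (SetReg 8 (ILit 0))))))"

definition tri_com :: com where
  "tri_com = Seq size_com (Seq scan_com fill_com)"

text \<open>Repeated addition of \<open>J\<close> replaces the index product. Registers 3, 5, 7 and
  8 are tracked because later phases start from their zeros.\<close>

lemma runs_size_com:
  assumes "ireg s 0 = J" "ireg s 1 = k" "ireg s 2 = 0" "ireg s 4 = 0"
    and "\<forall>x \<in> {3, 5, 7, 8}. ireg s x = 0"
  shows "runs size_com s (\<lambda>t s'. t \<le> 12 * k + 4 \<and>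
    ireg s' 0 = J \<and> ireg s' 2 = k * J \<and> carr s' = carr s \<and> (\<forall>x \<in> {3, 5, 7, 8}. ireg s' x = 0))"
  unfolding size_com_def
  apply (rule runs_Loop [where m = k and T = 8 and I = "\<lambda>i s'.
    ireg s' 0 = J \<and> ireg s' 1 = k \<and> ireg s' 2 = i * J \<and> ireg s' 4 = i \<and> carr s' = carr s \<and>
    (\<forall>x \<in> {3, 5, 7, 8}. ireg s' x = 0)"])
  using assms by auto

text \<open>Attainment of the bound gives that the measured width is at most any band limit of \<open>H\<close>.\<close>

definition upper_width_upto :: "(nat \<times> nat) set \<Rightarrow> (nat \<Rightarrow> nat \<Rightarrow> complex) \<Rightarrow> nat \<Rightarrow> bool" where
  "upper_width_upto S h B \<longleftrightarrow>
     (\<forall>(r, l) \<in> S. h r l \<noteq> 0 \<longrightarrow> l \<le> r + B) \<and>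
     (B = 0 \<or> (\<exists>(r, l) \<in> S. h r l \<noteq> 0 \<and> l = r + B))"

text \<open>The conditional mirrors the update in \<open>scan_row_com\<close>; a raised width is
  attained by the new entry itself.\<close>

lemma upper_width_upto_insert:
  assumes "upper_width_upto S h B"
  shows "upper_width_upto (insert (r, l) S) h (if h r l \<noteq> 0 \<and> B < l - r then l - r else B)"
  using assms by (fastforce simp: upper_width_upto_def)

lemma runs_scan_row_com:
  assumes "ireg s 2 = n" "ireg s 5 = r" "ireg s 6 = 0" "ireg s 0 = J" "carr s = C"
    and "upper_width_upto ({..<r} \<times> {..<n}) (C 0) (ireg s 3)"
    and "\<forall>x \<in> {7, 8}. ireg s x = 0"
  shows "runs scan_row_com s (\<lambda>t s'. t \<le> 26 * n + 4 \<and>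
    ireg s' 0 = J \<and> ireg s' 2 = n \<and> ireg s' 5 = r \<and> carr s' = C \<and>
    upper_width_upto ({..<Suc r} \<times> {..<n}) (C 0) (ireg s' 3) \<and> (\<forall>x \<in> {7, 8}. ireg s' x = 0))"
proof -
  have ins: "{..<r} \<times> {..<n} \<union> {r} \<times> {..<Suc l} = insert (r, l) ({..<r} \<times> {..<n} \<union> {r} \<times> {..<l})" for l
    by auto
  show ?thesis
    unfolding scan_row_com_def
    apply (rule runs_Loop [where m = n and T = 22 and I = "\<lambda>l s'.
      ireg s' 0 = J \<and> ireg s' 2 = n \<and> ireg s' 5 = r \<and> ireg s' 6 = l \<and> carr s' = C \<and>
      upper_width_upto ({..<r} \<times> {..<n} \<union> {r} \<times> {..<l}) (C 0) (ireg s' 3) \<and>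
      (\<forall>x \<in> {7, 8}. ireg s' x = 0)"])
       apply (use assms in simp)
    subgoal for l s
      using upper_width_upto_insert [of "{..<r} \<times> {..<n} \<union> {r} \<times> {..<l}" "C 0" "ireg s 3" r l]
      by (auto simp: ins simp del: Un_insert_right split: if_splits)
     apply simp
    apply (simp add: lessThan_Suc)
    by (metis (no_types, lifting) Sigma_Un_distrib1 Un_commute insert_is_Un)
qed

lemma runs_scan_com:
  assumes "ireg s 0 = J" "ireg s 2 = n" "carr s = C" "\<forall>x \<in> {3, 5, 7, 8}. ireg s x = 0"
  shows "runs scan_com s (\<lambda>t s'. t \<le> n * (26 * n + 14) + 4 \<and>
    ireg s' 0 = J \<and> ireg s' 2 = n \<and> carr s' = C \<and>
    upper_width_upto ({..<n} \<times> {..<n}) (C 0) (ireg s' 3) \<and> (\<forall>x \<in> {7, 8}. ireg s' x = 0))"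
  unfolding scan_com_def
  apply (rule runs_Loop [where m = n and T = "26 * n + 10" and I = "\<lambda>r s'.
    ireg s' 0 = J \<and> ireg s' 2 = n \<and> ireg s' 5 = r \<and> carr s' = C \<and>
    upper_width_upto ({..<r} \<times> {..<n}) (C 0) (ireg s' 3) \<and> (\<forall>x \<in> {7, 8}. ireg s' x = 0)"])
     apply (use assms in \<open>simp add: upper_width_upto_def\<close>)
  subgoal for r s
    apply simp
    apply (rule runs_mono [OF runs_scan_row_com [where n = n and r = r and J = J and C = C]])
    by auto
  by (auto simp: algebra_simps)

section \<open>Filling the columns with band-limited sums\<close>

context
  fixes h :: "nat \<Rightarrow> nat \<Rightarrow> complex" and n J B :: nat
  assumes outside: "\<And>r l. n \<le> r \<or> n \<le> l \<Longrightarrow> h r l = 0"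
    and hessenberg: "\<And>r l. l + 1 < r \<Longrightarrow> h r l = 0"
    and width: "\<And>r l. r + B < l \<Longrightarrow> h r l = 0"
    and J_pos: "0 < J"
begin

abbreviation (input) coeff :: "nat \<Rightarrow> nat \<Rightarrow> complex" where
  "coeff \<equiv> krylov_coeff h n J"

text \<open>Rows from \<open>n\<close> on are never written; this shows that their initial zeros are
  the right values.\<close>

lemma coeff_outside: "c < n \<Longrightarrow> n \<le> r \<Longrightarrow> coeff c r = 0"
  by (cases c) (auto simp: outside)

text \<open>Terms left of \<open>r - 1\<close> vanish by the Hessenberg form and those right of
  \<open>r + B\<close> by the width. At most \<open>B + 2\<close> terms remain, which is what makes
  banded matrices cheap.\<close>

lemma coeff_band_sum:
  assumes "c mod J \<noteq> 0"
  shows "coeff c r = (\<Sum>l = r - 1..<r + B + 1. h r l * coeff (c - 1) l)"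
proof -
  \<comment> \<open>Neither range need contain the other, so both are compared with their
    union.\<close>
  have "(\<Sum>l<n. h r l * coeff (c - 1) l) =
      (\<Sum>l \<in> {..<n} \<union> {r - 1..<r + B + 1}. h r l * coeff (c - 1) l)"
    by (rule sum.mono_neutral_left) (auto simp: outside)
  also have "\<dots> = (\<Sum>l = r - 1..<r + B + 1. h r l * coeff (c - 1) l)"
    by (rule sum.mono_neutral_right) (auto simp: hessenberg width)
  finally show ?thesis using krylov_coeff_step [OF assms] by simp
qed

lemma runs_entry_com:
  assumes "ireg s 0 = J" "ireg s 2 = n" "ireg s 3 = B" "ireg s 7 = c" "ireg s 8 = c mod J"
    and "ireg s 9 = r" "ireg s 10 = r - 1" "ireg s 11 = r + B + 1" "carr s 0 = h" "c mod J \<noteq> 0"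
    and "\<forall>r' c'. carr s 1 r' c' = (if c' < c \<or> c' = c \<and> r' < r then coeff c' r' else 0)"
  shows "runs entry_com s (\<lambda>t s'. t \<le> 24 * (B + 2) + 4 \<and>
    ireg s' 0 = J \<and> ireg s' 2 = n \<and> ireg s' 3 = B \<and> ireg s' 7 = c \<and> ireg s' 8 = c mod J \<and>
    ireg s' 9 = r \<and> carr s' 0 = h \<and>
    (\<forall>r' c'. carr s' 1 r' c' = (if c' < c \<or> c' = c \<and> r' < Suc r then coeff c' r' else 0)))"
proof -
  \<comment> \<open>This makes \<open>c - 1\<close> a different, finished column, undisturbed by
    writes to column \<open>c\<close>.\<close>
  have c: "0 < c" using assms by (cases c) auto
  \<comment> \<open>The range has \<open>B + 2\<close> elements, or \<open>B + 1\<close> if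
    \<open>r = 0\<close>, where \<open>r - 1\<close> truncates to 0.\<close>
  have le: "(r + B + 1 - (r - 1)) * 24 + 4 \<le> 24 * (B + 2) + 4" by simp
  have fin: "r - 1 + (r + B + 1 - (r - 1)) = r + B + 1" by simp
  show ?thesis
    unfolding entry_com_def
    \<comment> \<open>Cell \<open>(r, c)\<close> holds a partial sum; an accumulation costs 16 and
      the increment 4.\<close>
    apply (rule runs_Loop [where m = "r + B + 1 - (r - 1)" and T = 20 and I = "\<lambda>i s'.
      ireg s' 0 = J \<and> ireg s' 2 = n \<and> ireg s' 3 = B \<and> ireg s' 7 = c \<and> ireg s' 8 = c mod J \<and>
      ireg s' 9 = r \<and> ireg s' 10 = r - 1 + i \<and> ireg s' 11 = r + B + 1 \<and> carr s' 0 = h \<and>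
      (\<forall>r' c'. carr s' 1 r' c' = (if c' < c \<or> c' = c \<and> r' < r then coeff c' r'
        else if c' = c \<and> r' = r then \<Sum>l = r - 1..<r - 1 + i. h r l * coeff (c - 1) l else 0))"])
    subgoal using assms by auto
    subgoal for i s using c by auto
    subgoal by simp
    subgoal for t s'
      apply (rule conjI)
       using le apply simp
      apply (simp only: fin coeff_band_sum [OF assms(10), symmetric])
      by (auto simp: less_Suc_eq)
    done
qed

lemma runs_column_com:
  assumes "ireg s 0 = J" "ireg s 2 = n" "ireg s 3 = B" "ireg s 7 = c" "ireg s 8 = c mod J"
    and "ireg s 9 = 0" "carr s 0 = h" "c mod J \<noteq> 0" "c < n"
    and "\<forall>r' c'. carr s 1 r' c' = (if c' < c then coeff c' r' else 0)"
  shows "runs column_com s (\<lambda>t s'. t \<le> n * (24 * B + 70) + 4 \<and>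
    ireg s' 0 = J \<and> ireg s' 2 = n \<and> ireg s' 3 = B \<and> ireg s' 7 = c \<and> ireg s' 8 = c mod J \<and>
    carr s' 0 = h \<and> (\<forall>r' c'. carr s' 1 r' c' = (if c' < Suc c then coeff c' r' else 0)))"
  unfolding column_com_def
  apply (rule runs_Loop [where m = n and T = "24 * B + 66" and I = "\<lambda>r s'.
    ireg s' 0 = J \<and> ireg s' 2 = n \<and> ireg s' 3 = B \<and> ireg s' 7 = c \<and> ireg s' 8 = c mod J \<and>
    ireg s' 9 = r \<and> carr s' 0 = h \<and>
    (\<forall>r' c'. carr s' 1 r' c' = (if c' < c \<or> c' = c \<and> r' < r then coeff c' r' else 0))"])
  subgoal using assms by simp
  subgoal for r s
    apply simp
    apply (rule runs_mono [OF runs_entry_com [where c = c and r = r]])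
    using assms(8) by auto
  subgoal by simp
  subgoal for t s'
    using coeff_outside [OF assms(9)] by (auto simp: algebra_simps less_Suc_eq not_less)
  done

lemma runs_fill_com:
  assumes "ireg s 0 = J" "ireg s 2 = n" "ireg s 3 = B" "ireg s 7 = 0" "ireg s 8 = 0"
    and "carr s 0 = h" "\<forall>r c. carr s 1 r c = 0"
  shows "runs fill_com s (\<lambda>t s'. t \<le> n * (n * (24 * B + 70) + 40) + 4 \<and>
    (\<forall>r c. c < n \<longrightarrow> carr s' 1 r c = coeff c r))"
  unfolding fill_com_def
  apply (rule runs_Loop [where m = n and T = "n * (24 * B + 70) + 36" and I = "\<lambda>c s'.
    ireg s' 0 = J \<and> ireg s' 2 = n \<and> ireg s' 3 = B \<and> ireg s' 7 = c \<and> ireg s' 8 = c mod J \<and>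
    carr s' 0 = h \<and>
    (\<forall>r' c'. carr s' 1 r' c' = (if c' < c then coeff c' r' else 0))"])
  subgoal using assms by simp
  subgoal for c s
    \<comment> \<open>A restart column writes only its diagonal one; its other entries are initial
      zeros.\<close>
    apply (cases "c mod J = 0")
    subgoal
      using J_pos by (auto simp: mod_Suc krylov_coeff_restart less_Suc_eq)
    subgoal
      apply simp
      apply (rule runs_mono [OF runs_column_com [where c = c]])
      using J_pos by (auto simp: mod_Suc) (metis Suc_lessI mod_less_divisor)+
    done
  subgoal by simp
  subgoal by (simp add: algebra_simps)
  done

end

text \<open>Zero extension, matching array 0 of the input store.\<close>

definition entries :: "complex mat \<Rightarrow> nat \<Rightarrow> nat \<Rightarrow> complex" where
  "entries H i j = (if i < dim_row H \<and> j < dim_col H then H $$ (i, j) else 0)"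

lemma carr_input_store: "carr (input_store J k H) 0 = entries H"
  by (auto simp: input_store_def entries_def fun_eq_iff)

text \<open>The measured width \<open>B\<close> is below \<open>n\<close> and at most every band
  limit, so one bound in terms of \<open>B\<close> yields both the cubic and the quadratic
  cost.\<close>

lemma runs_tri_com:
  assumes H: "H \<in> carrier_mat n n" "upper_hessenberg H" and n: "k * J = n" "0 < n"
  shows "runs tri_com (input_store J k H) (\<lambda>t s'.
    (\<exists>B < n. (\<forall>b. banded b H \<longrightarrow> B \<le> b) \<and> t \<le> 174 * (B + 1) * n ^ 2) \<and>
    (\<forall>r c. c < n \<longrightarrow> carr s' 1 r c = krylov_coeff (entries H) n J c r))"
proof -
  have J: "0 < J" "k \<le> n" using n by (cases J; auto)+
  have dim: "dim_row H = n" "dim_col H = n" using H by auto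
  let ?C = "carr (input_store J k H)"
  let ?Q = "\<lambda>t s'. (\<exists>B < n. (\<forall>b. banded b H \<longrightarrow> B \<le> b) \<and> t \<le> 174 * (B + 1) * n ^ 2) \<and>
    (\<forall>r c. c < n \<longrightarrow> carr s' 1 r c = krylov_coeff (entries H) n J c r)"
  have fill: "runs fill_com s (\<lambda>t'. ?Q (t + t'))"
    if s: "ireg s 0 = J" "ireg s 2 = n" "carr s = ?C" "\<forall>x \<in> {7, 8}. ireg s x = 0"
      and w: "upper_width_upto ({..<n} \<times> {..<n}) (?C 0) (ireg s 3)"
      and t: "t \<le> 12 * k + 4 + (n * (26 * n + 14) + 4)" for s t
  proof -
    define B where "B = ireg s 3"
    note w = w [folded B_def, unfolded carr_input_store upper_width_upto_def]
    have "B < n" using w n by auto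
    have band: "B \<le> b" if "banded b H" for b
    proof (cases "B = 0")
      case False
      \<comment> \<open>The width is attained by a nonzero entry, which every band must
        contain.\<close>
      with w obtain r l where rl: "r < n" "l < n" "entries H r l \<noteq> 0" "l = r + B" by auto
      then have "\<not> r + b < l"
        using that by (auto simp: banded_def entries_def dim)
      with rl show ?thesis by simp
    qed simp
    have "t + t' \<le> 174 * (B + 1) * n ^ 2" if t': "t' \<le> n * (n * (24 * B + 70) + 40) + 4" for t'
    proof -
      \<comment> \<open>Bounding \<open>n\<close> and 1 by \<open>n ^ 2\<close> turns the
        coefficients 66, 12 and 96 below into their sum 174.\<close>
      have "n \<le> n ^ 2" "1 \<le> n ^ 2" "0 \<le> B * n ^ 2" using n by (auto simp: power2_eq_square)
      moreover have "t + t' \<le> 66 * n + 12 * 1 + 96 * n ^ 2 + 24 * (B * n ^ 2)"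
        using t t' J by (simp add: algebra_simps power2_eq_square)
      ultimately have "t + t' \<le> 174 * n ^ 2 + 174 * (B * n ^ 2)" by linarith
      then show ?thesis by (simp add: algebra_simps)
    qed
    moreover have "runs fill_com s (\<lambda>t s'. t \<le> n * (n * (24 * B + 70) + 40) + 4 \<and>
        (\<forall>r c. c < n \<longrightarrow> carr s' 1 r c = krylov_coeff (entries H) n J c r))"
    proof -
      have "entries H r l = 0" if "n \<le> r \<or> n \<le> l" for r l
        using that by (auto simp: entries_def dim)
      moreover have "entries H r l = 0" if "l + 1 < r" for r l
        using H that by (auto simp: entries_def upper_hessenberg_def)
      moreover have "entries H r l = 0" if "r + B < l" for r l
        using w that by (fastforce simp: entries_def dim)
      moreover have "\<forall>r c. carr s 1 r c = 0"
        unfolding s(3) by (simp add: input_store_def)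
      moreover have "carr s 0 = entries H"
        unfolding s(3) by (rule carr_input_store)
      moreover have "ireg s 7 = 0" "ireg s 8 = 0"
        using s(4) by simp_all
      ultimately show ?thesis
        using s(1,2) J(1) by (intro runs_fill_com) (assumption | simp add: B_def)+
    qed
    ultimately show ?thesis
      using \<open>B < n\<close> band by (elim runs_mono) blast
  qed
  show ?thesis
    unfolding tri_com_def runs_Seq
    apply (rule runs_mono [OF runs_size_com [where J = J and k = k]])
         apply (simp_all add: input_store_def) [5]
    apply (rule runs_mono [OF runs_scan_com [where J = J and n = n and C = "?C"]])
        apply (use n in auto) [4]
    subgoal for t s t' s'
      using fill [of s' "t + t'"] by (simp add: ac_simps)
    done
qed

section \<open>Krylov vectors of a Hessenberg decomposition\<close>

text \<open>Matrix powers unfold with the new factor on the right, whereas the Krylov recursion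
  applies it on the left.\<close>

lemma pow_mat_Suc_mult_vec:
  assumes A: "A \<in> carrier_mat N N" and x: "x \<in> carrier_vec N"
  shows "A ^\<^sub>m Suc j *\<^sub>v x = A *\<^sub>v (A ^\<^sub>m j *\<^sub>v x)"
  using x
proof (induction j arbitrary: x)
  case 0
  then show ?case using A by simp
next
  case (Suc j)
  have P: "A ^\<^sub>m j \<in> carrier_mat N N" "A ^\<^sub>m Suc j \<in> carrier_mat N N" for j
    using A by (auto intro: pow_carrier_mat)
  have "A ^\<^sub>m Suc (Suc j) *\<^sub>v x = A ^\<^sub>m Suc j *\<^sub>v (A *\<^sub>v x)"
    using assoc_mult_mat_vec [OF P(2) A Suc.prems] by simp
  also have "\<dots> = A *\<^sub>v (A ^\<^sub>m j *\<^sub>v (A *\<^sub>v x))"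
    using Suc.IH A Suc.prems by simp
  also have "A ^\<^sub>m j *\<^sub>v (A *\<^sub>v x) = A ^\<^sub>m Suc j *\<^sub>v x"
    using assoc_mult_mat_vec [OF P(1) A Suc.prems] by simp
  finally show ?case .
qed

lemma mult_unit_vec:
  fixes V :: "'a :: semiring_1 mat"
  assumes V: "V \<in> carrier_mat N n" and c: "c < n"
  shows "V *\<^sub>v unit_vec n c = col V c"
  using V c by (intro eq_vecI) auto

lemma append_col_mult_vec:
  fixes V :: "'a :: comm_semiring_1 mat"
  assumes V: "V \<in> carrier_mat N n" and v: "v \<in> carrier_vec N"
    and y: "y \<in> carrier_vec (n + 1)" "y $ n = 0"
  shows "append_col V v *\<^sub>v y = V *\<^sub>v vec n (($) y)"
proof (rule eq_vecI)
  fix r assume "r < dim_vec (V *\<^sub>v vec n (($) y))"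
  then have r: "r < N" using V by simp
  have "append_col V v $$ (r, l) = V $$ (r, l)" if "l < n" for l
    using V r that by (simp add: append_col_def mat_of_cols_index nth_append)
  then show "(append_col V v *\<^sub>v y) $ r = (V *\<^sub>v vec n (($) y)) $ r"
    using V v y r by (simp add: scalar_prod_def append_col_def)
qed (use V in \<open>simp add: append_col_def\<close>)

text \<open>The last row of \<open>Hbar\<close> can be nonzero only in column \<open>n - 1\<close>,
  where \<open>x\<close> vanishes; so \<open>v\<close> receives weight 0.\<close>

lemma hessenberg_decomposition_mult_vec:
  assumes D: "hessenberg_decomposition N n A V v Hbar"
    and x: "x \<in> carrier_vec n" "x $ (n - 1) = 0" "0 < n"
  shows "A *\<^sub>v (V *\<^sub>v x) = V *\<^sub>v (first_rows n Hbar *\<^sub>v x)"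
proof -
  from D have A: "A \<in> carrier_mat N N" and V: "V \<in> carrier_mat N n" and v: "v \<in> carrier_vec N"
    and Hbar: "Hbar \<in> carrier_mat (n + 1) n" and up: "upper_hessenberg Hbar"
    and eq: "A * V = append_col V v * Hbar"
    by (auto simp: hessenberg_decomposition_def)
  have W: "append_col V v \<in> carrier_mat N (n + 1)"
    using V by (auto simp: append_col_def)
  have "Hbar $$ (n, l) * x $ l = 0" if "l < n" for l
  proof (cases "l = n - 1")
    case False
    with that have "n > l + 1" by simp
    then show ?thesis using up Hbar that by (auto simp: upper_hessenberg_def)
  qed (use x in simp)
  then have last: "(Hbar *\<^sub>v x) $ n = 0"
    using Hbar x by (auto simp: scalar_prod_def intro!: sum.neutral)
  have "A *\<^sub>v (V *\<^sub>v x) = append_col V v *\<^sub>v (Hbar *\<^sub>v x)"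
    using assoc_mult_mat_vec [OF A V x(1)] assoc_mult_mat_vec [OF W Hbar x(1)] eq by simp
  also have "\<dots> = V *\<^sub>v vec n (($) (Hbar *\<^sub>v x))"
    using mult_mat_vec_carrier [OF Hbar x(1)] last by (rule append_col_mult_vec [OF V v])
  also have "vec n (($) (Hbar *\<^sub>v x)) = first_rows n Hbar *\<^sub>v x"
    using Hbar x by (intro eq_vecI) (auto simp: first_rows_def scalar_prod_def)
  finally show ?thesis .
qed

lemma krylov_coeff_column:
  assumes D: "hessenberg_decomposition N n A V v Hbar"
    and n: "0 < n" and c: "i * J + j < n" and j: "j < J"
  shows "V *\<^sub>v vec n (krylov_coeff (entries (first_rows n Hbar)) n J (i * J + j)) =
    A ^\<^sub>m j *\<^sub>v col V (i * J)"
  using c j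
proof (induction j)
  case 0
  from D have A: "A \<in> carrier_mat N N" and V: "V \<in> carrier_mat N n"
    by (auto simp: hessenberg_decomposition_def)
  have "vec n (krylov_coeff (entries (first_rows n Hbar)) n J (i * J)) = unit_vec n (i * J)"
    by (intro eq_vecI) (auto simp: krylov_coeff_restart unit_vec_def)
  then show ?case
    using mult_unit_vec [OF V, of "i * J"] 0 A V by (simp add: col_carrier_vec)
next
  case (Suc j)
  from D have A: "A \<in> carrier_mat N N" and V: "V \<in> carrier_mat N n"
    and Hbar: "Hbar \<in> carrier_mat (n + 1) n" "upper_hessenberg Hbar"
    by (auto simp: hessenberg_decomposition_def)
  define H where "H = first_rows n Hbar"
  have H: "H \<in> carrier_mat n n" using Hbar by (auto simp: H_def first_rows_def)
  define x where "x = (\<lambda>c. vec n (krylov_coeff (entries H) n J c))"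
  have zero: "entries H r l = 0" if "l + 1 < r" for r l
    using Hbar that by (auto simp: entries_def H_def first_rows_def upper_hessenberg_def)
  \<comment> \<open>As \<open>i * J + Suc j < n\<close>, this column lies left of the last one, and
    triangularity applies.\<close>
  have "x (i * J + j) $ (n - 1) = 0"
    using krylov_coeff_upper [where c = "i * J + j" and r = "n - 1", OF zero] Suc.prems by (simp add: x_def)
  then have "A *\<^sub>v (V *\<^sub>v x (i * J + j)) = V *\<^sub>v (H *\<^sub>v x (i * J + j))"
    unfolding H_def by (intro hessenberg_decomposition_mult_vec [OF D]) (auto simp: x_def n)
  also have "H *\<^sub>v x (i * J + j) = x (i * J + Suc j)"
  proof (rule eq_vecI)
    \<comment> \<open>No restart occurs inside a block, because \<open>Suc j < J\<close>.\<close>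
    have "(i * J + Suc j) mod J \<noteq> 0" using Suc.prems by simp
    note step = krylov_coeff_step [OF this, simplified add_Suc_right diff_Suc_1]
    fix r assume "r < dim_vec (x (i * J + Suc j))"
    then have "r < n" by (simp add: x_def)
    then show "(H *\<^sub>v x (i * J + j)) $ r = x (i * J + Suc j) $ r"
      using H by (simp add: step x_def scalar_prod_def entries_def lessThan_atLeast0 del: krylov_coeff.simps)
  qed (use H in \<open>simp add: x_def\<close>)
  finally have "V *\<^sub>v x (i * J + Suc j) = A *\<^sub>v (A ^\<^sub>m j *\<^sub>v col V (i * J))"
    using Suc by (simp add: x_def H_def)
  also have "\<dots> = A ^\<^sub>m Suc j *\<^sub>v col V (i * J)"
    using V by (intro pow_mat_Suc_mult_vec [OF A, symmetric] carrier_vecI) simp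
  finally show ?case by (simp only: x_def H_def)
qed

section \<open>Columns of the block Krylov matrix\<close>

lemma length_concat_uniform:
  "\<forall>xs \<in> set xss. length xs = k \<Longrightarrow> length (concat xss) = length xss * k"
  by (induction xss) auto

lemma nth_concat_uniform:
  assumes "\<forall>xs \<in> set xss. length xs = k" "j < length xss" "i < k"
  shows "concat xss ! (j * k + i) = xss ! j ! i"
  using assms
proof (induction xss arbitrary: j)
  case (Cons xs xss)
  then show ?case by (cases j) (auto simp: nth_append)
qed simp

lemma dim_col_block_krylov:
  "dim_col (block_krylov J A W) = J * dim_col W"
proof -
  have "\<forall>xs \<in> set (map (\<lambda>j. cols (A ^\<^sub>m j * W)) [0..<J]). length xs = dim_col W"
    by simp
  from length_concat_uniform [OF this] show ?thesis by (simp add: block_krylov_def)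
qed

lemma col_block_krylov:
  assumes A: "A \<in> carrier_mat N N" and W: "W \<in> carrier_mat N k" and "j < J" "i < k"
  shows "col (block_krylov J A W) (j * k + i) = A ^\<^sub>m j *\<^sub>v col W i"
proof -
  let ?xss = "map (\<lambda>j. cols (A ^\<^sub>m j * W)) [0..<J]"
  have P: "A ^\<^sub>m j \<in> carrier_mat N N" using A by (rule pow_carrier_mat)
  have vec: "col (A ^\<^sub>m j * W) i \<in> carrier_vec N" using A W by (intro carrier_vecI) simp
  have len: "\<forall>xs \<in> set ?xss. length xs = k" using W by auto
  have "j * k + i < (j + 1) * k" using assms by simp
  also have "\<dots> \<le> J * k" using assms by (intro mult_le_mono1) simp
  finally have less: "j * k + i < J * k" .
  have nth: "concat ?xss ! (j * k + i) = col (A ^\<^sub>m j * W) i"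
    using nth_concat_uniform [OF len, of j i] assms W by simp
  have "col (block_krylov J A W) (j * k + i) = concat ?xss ! (j * k + i)"
    unfolding block_krylov_def
    using less length_concat_uniform [OF len] nth vec W assms
    by (intro col_mat_of_cols) auto
  also have "\<dots> = A ^\<^sub>m j *\<^sub>v col W i"
    using nth col_mult2 [OF P W] assms by simp
  finally show ?thesis .
qed

text \<open>Compared by columns: right multiplication by the permutation matrix selects column
  \<open>p c\<close>, which for \<open>c = i * J + j\<close> is column \<open>i\<close> of block
  \<open>j\<close>.\<close>

lemma krylov_factorization:
  assumes D: "hessenberg_decomposition N n A V v Hbar" and n: "k * J = n" "0 < n"
    and p: "\<forall>c < n. p c = stride_perm J k c"
    and K: "K \<in> carrier_mat n n"
      "\<forall>r c. r < n \<and> c < n \<longrightarrow> K $$ (r, c) = krylov_coeff (entries (first_rows n Hbar)) n J c r"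
  shows "V * K = block_krylov J A (strided_cols J k V) * matrix_of_perm n p"
proof -
  from D have A: "A \<in> carrier_mat N N" and V: "V \<in> carrier_mat N n"
    by (auto simp: hessenberg_decomposition_def)
  define W where "W = strided_cols J k V"
  have W: "W \<in> carrier_mat N k" using V by (auto simp: W_def strided_cols_def)
  define B where "B = block_krylov J A W"
  have B: "B \<in> carrier_mat N n"
    using W n dim_col_block_krylov [of J A W] by (auto simp: B_def block_krylov_def ac_simps)
  have P: "matrix_of_perm n p \<in> carrier_mat n n" by (simp add: matrix_of_perm_def)
  have "col (V * K) c = col (B * matrix_of_perm n p) c" if c: "c < n" for c
  proof -
    have J: "0 < J" using n by (cases J) auto
    define i j where "i = c div J" and "j = c mod J"
    have ij: "i < k" "j < J" "i * J + j = c"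
      using J c n by (auto simp: i_def j_def less_mult_imp_div_less)
    have pc: "p c = j * k + i" "p c < n"
      using p c stride_perm_less [of c k J] n by (auto simp: stride_perm_def i_def j_def)
    have "i * J < n" using ij c by linarith
    have "col (V * K) c = V *\<^sub>v col K c" using col_mult2 [OF V K(1) c] .
    also have "col K c = vec n (krylov_coeff (entries (first_rows n Hbar)) n J (i * J + j))"
      using K c ij by (intro eq_vecI) auto
    also have "V *\<^sub>v \<dots> = A ^\<^sub>m j *\<^sub>v col V (i * J)"
      using krylov_coeff_column [OF D n(2)] ij c by blast
    also have "col V (i * J) = col W i"
      using V ij by (simp add: W_def strided_cols_def carrier_vecI)
    also have "A ^\<^sub>m j *\<^sub>v \<dots> = col B (p c)"
      using col_block_krylov [OF A W] ij pc by (simp add: B_def)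
    also have "\<dots> = B *\<^sub>v unit_vec n (p c)"
      using mult_unit_vec [OF B] pc by simp
    also have "unit_vec n (p c) = col (matrix_of_perm n p) c"
      using c by (intro eq_vecI) (auto simp: matrix_of_perm_def unit_vec_def)
    also have "B *\<^sub>v \<dots> = col (B * matrix_of_perm n p) c"
      by (rule col_mult2 [OF B P c, symmetric])
    finally show ?thesis .
  qed
  then show ?thesis
    unfolding W_def [symmetric] B_def [symmetric]
    using V K B P by (intro mat_col_eqI) auto
qed

text \<open>Programs and constants are chosen before all sizes and data, so they are uniform;
  \<open>C2\<close> may depend on the band limit alone.\<close>

theorem theorem1:
  shows "\<exists>(perm_prog :: com) (tri_prog :: com) (C1 :: nat) (C3 :: nat) (C2 :: nat \<Rightarrow> nat).
    \<forall>(N :: nat) (n :: nat) (J :: nat) (k :: nat)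
      (A :: complex mat) (V :: complex mat) (v :: complex vec) (Hbar :: complex mat).
      0 < N \<and> 0 < n \<and> 0 < J \<and> 0 < k \<and> k * J = n \<and>
      hessenberg_decomposition N n A V v Hbar \<longrightarrow>
      (let H = first_rows n Hbar; Vt = strided_cols J k V in
       \<exists>t1 W1 s1 t2 W2 s2.
         exec perm_prog (input_store J k H) t1 W1 s1 \<and>
         t1 \<le> C1 * n \<and> card W1 \<le> C1 * n \<and>
         exec tri_prog (input_store J k H) t2 W2 s2 \<and>
         t2 \<le> C3 * n ^ 3 \<and> card W2 \<le> C3 * n ^ 3 \<and>
         (\<forall>b. banded b H \<longrightarrow> t2 \<le> C2 b * n ^ 2 \<and> card W2 \<le> C2 b * n ^ 2) \<and>
         (let P = stored_perm_matrix n s1; K = stored_matrix n s2 in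
            permutation_matrix n P \<and> upper_triangular K \<and>
            V * K = block_krylov J A Vt * P))"
proof (rule exI [of _ perm_com], rule exI [of _ tri_com], rule exI [of _ 39], rule exI [of _ 174],
    rule exI [of _ "\<lambda>b. 174 * (b + 1)"], intro allI impI)
  fix N n J k :: nat and A V Hbar :: "complex mat" and v :: "complex vec"
  assume asm: "0 < N \<and> 0 < n \<and> 0 < J \<and> 0 < k \<and> k * J = n \<and>
    hessenberg_decomposition N n A V v Hbar"
  then have n: "k * J = n" "0 < n" and D: "hessenberg_decomposition N n A V v Hbar" by auto
  define H where "H = first_rows n Hbar"
  from D have Hbar: "Hbar \<in> carrier_mat (n + 1) n" "upper_hessenberg Hbar"
    by (auto simp: hessenberg_decomposition_def)
  have H: "H \<in> carrier_mat n n" "upper_hessenberg H"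
    using Hbar by (auto simp: H_def first_rows_def upper_hessenberg_def)
  obtain t1 W1 s1 where e1: "exec perm_com (input_store J k H) t1 W1 s1"
    and t1: "t1 \<le> k * (19 * J + 16) + 4" and p: "\<forall>c < n. iarr s1 0 c = stride_perm J k c"
    using runs_perm_com [of "input_store J k H" J k] n
    by (auto simp: runs_def input_store_def)
  have "k \<le> n" using n by (cases J) auto
  \<comment> \<open>With \<open>k \<le> n\<close> and \<open>1 \<le> n\<close>, the coefficients 19,
    16 and 4 add up to 39.\<close>
  have "k * (19 * J + 16) = 19 * n + 16 * k" using n by (simp add: algebra_simps)
  with t1 have "t1 \<le> 19 * n + 16 * k + 4" by (simp only:)
  with \<open>k \<le> n\<close> n(2) have t1: "t1 \<le> 39 * n" by linarith
  obtain t2 W2 s2 B where e2: "exec tri_com (input_store J k H) t2 W2 s2"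
    and B: "B < n" "\<forall>b. banded b H \<longrightarrow> B \<le> b" and t2: "t2 \<le> 174 * (B + 1) * n ^ 2"
    and K: "\<forall>r c. c < n \<longrightarrow> carr s2 1 r c = krylov_coeff (entries H) n J c r"
    using runs_tri_com [OF H n] unfolding runs_def by blast
  \<comment> \<open>Taken at \<open>m = b\<close> for a banded \<open>H\<close>, and at
    \<open>m = n - 1\<close> for the cubic bound.\<close>
  have quadratic: "t2 \<le> 174 * (m + 1) * n ^ 2" if "B \<le> m" for m
    using that by (intro order.trans [OF t2] mult_le_mono1 mult_le_mono2) simp
  have cubic: "t2 \<le> 174 * n ^ 3"
  proof -
    have "B \<le> n - 1" using B by simp
    from quadratic [OF this] n(2) show ?thesis by (simp add: power3_eq_cube power2_eq_square)
  qed
  have card: "card W1 \<le> t1" "card W2 \<le> t2"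
    using e1 e2 by (auto intro: card_written_le)
  have perm: "permutation_matrix n (stored_perm_matrix n s1)"
    using permutation_matrix_stride_perm [of k J "iarr s1 0"] p n by (simp add: stored_perm_matrix_def)
  have tri: "upper_triangular (stored_matrix n s2)"
    using H K krylov_coeff_upper [of "entries H"]
    by (auto simp: stored_matrix_def upper_triangular_def entries_def upper_hessenberg_def)
  have "V * stored_matrix n s2 = block_krylov J A (strided_cols J k V) * stored_perm_matrix n s1"
    unfolding stored_perm_matrix_def
    using krylov_factorization [OF D n p] K by (simp add: stored_matrix_def H_def)
  with e1 e2 t1 cubic quadratic B card perm tri
  show "let H = first_rows n Hbar; Vt = strided_cols J k V in
       \<exists>t1 W1 s1 t2 W2 s2.
         exec perm_com (input_store J k H) t1 W1 s1 \<and>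
         t1 \<le> 39 * n \<and> card W1 \<le> 39 * n \<and>
         exec tri_com (input_store J k H) t2 W2 s2 \<and>
         t2 \<le> 174 * n ^ 3 \<and> card W2 \<le> 174 * n ^ 3 \<and>
         (\<forall>b. banded b H \<longrightarrow> t2 \<le> 174 * (b + 1) * n ^ 2 \<and> card W2 \<le> 174 * (b + 1) * n ^ 2) \<and>
         (let P = stored_perm_matrix n s1; K = stored_matrix n s2 in
            permutation_matrix n P \<and> upper_triangular K \<and>
            V * K = block_krylov J A Vt * P)"
    unfolding Let_def H_def [symmetric] by (meson order.trans)
qed

end
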